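(* A conservative but adjoint inconsistent SBP-SAT discretization (as in the context) of the homogeneous diffusion problem, i.e. $\mathcal F=0$, $\mathcal U_D=0$, $\mathcal U_N=0$, is energy stable with respect to the diagonal norm matrix $H$ if, for every interior facet $\gamma$ shared by $\Omega_k$ and $\Omega_v$ (and every Dirichlet facet in the condition on $T^{(D)}_\gamma$), $$T^{(3)}_{\gamma k}+T^{(2)}_{\gamma k}-B_\gamma=0,\quad T^{(3)}_{\gamma v}+T^{(2)}_{\gamma v}-B_\gamma=0,\quad T^{(3)}_{\gamma v}-T^{(2)}_{\gamma k}=0,\quad T^{(3)}_{\gamma k}-T^{(2)}_{\gamma v}=0,$$ $$T^{(1)}_{\gamma k}\succeq0,\quad T^{(4)}_{\gamma k}=T^{(4)}_{\gamma v}\succeq0,\quad T^{(D)}_\gamma-\frac1{\alpha_{\gamma k}}B_\gamma\Upsilon_{\gamma\gamma k}B_\gamma\succeq0,\quad T^{(5)}_{abk}=-T^{(6)}_{abk}=0,$$ where for element $\Omega_k$ and facets $a,b\in\{\gamma,\epsilon_1,\epsilon_2,\delta_1,\delta_2\}$ $$\Upsilon_{abk}=N_{ak}^T\bar R_{ak}\bar H_k^{-1}\Lambda_k\bar R_{bk}^TN_{bk}.$$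
   Context: **Problem.** $\Omega\subset\mathbb R^2$ is compact with piecewise smooth boundary $\Gamma^D\cup\Gamma^N$ ($\Gamma^D\ne\emptyset$), $\lambda$ a symmetric positive definite (SPD) $2\times2$ tensor field. $\partial_t\mathcal U-\nabla\cdot(\lambda\nabla\mathcal U)=\mathcal F$ in $\Omega$, $\mathcal U=\mathcal U_D$ on $\Gamma^D$, $(\lambda\nabla\mathcal U)\cdot n=\mathcal U_N$ on $\Gamma^N$. **Mesh.** $\Omega$ is partitioned into non-overlapping (possibly curved) triangles $\Omega_k$. $\Gamma_k$ denotes the facets (edges) of $\Omega_k$, $\Gamma_k^I$ those that are interior. For an interior facet $\gamma$ of $\Omega_k$, $\Omega_v$ is the neighbour across $\gamma$; $\epsilon\in\{\epsilon_1,\epsilon_2\}$ runs over the other interior facets of $\Omega_k$ (neighbour $\Omega_g$) and $\delta\in\{\delta_1,\delta_2\}$ over the other interior facets of $\Omega_v$ (neighbour $\Omega_q$). **Operators.** On $\Omega_k$ with $n_p$ volume nodes and $n_f$ nodes per facet: $H_k$ is a diagonal SPD matrix; $B_\gamma$ is the diagonal matrix of positive facet quadrature weights on $\gamma$ (common to both adjacent elements); $N_{x\gamma k},N_{y\gamma k}$ are the diagonal matrices of the components of the outward unit normal of $\Omega_k$ at the nodes of $\gamma$; $R_{\gamma k}\in\mathbb R^{n_f\times n_p}$ extrapolates from volume nodes to the nodes of $\gamma$; the derivative matrices satisfy the SBP property $H_kD_{xk}+(H_kD_{xk})^T=\sum_{\gamma\subset\Gamma_k}R_{\gamma k}^TB_\gamma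 N_{x\gamma k}R_{\gamma k}$ and similarly for $y$. $\Lambda_k$ is the SPD $2\times2$ block matrix with diagonal blocks holding the entries of $\lambda$ at the volume nodes. $N_{\gamma k}=\begin{bmatrix}N_{x\gamma k}\\ N_{y\gamma k}\end{bmatrix}$, $\bar R_{\gamma k}=\mathrm{diag}(R_{\gamma k},R_{\gamma k})$, $\bar H_k=\mathrm{diag}(H_k,H_k)$, $D^{(2)}_k=[D_{xk}\; D_{yk}]\Lambda_k\begin{bmatrix}D_{xk}\\ D_{yk}\end{bmatrix}$, $D_{\gamma k}=N_{\gamma k}^T\bar R_{\gamma k}\Lambda_k\begin{bmatrix}D_{xk}\\ D_{yk}\end{bmatrix}$. The facet weights $\alpha_{\gamma k}>0$ satisfy $\sum_{\gamma\subset\Gamma_k}\alpha_{\gamma k}=1$ for each $k$. **Discretization.** $\frac{du_{h,k}}{dt}=D^{(2)}_ku_{h,k}+f_k-H_k^{-1}s_k^I-H_k^{-1}s_k^B$, with $n_f\times n_f$ coefficient matrices $T$ and $$s_k^I=\sum_{\gamma\subset\Gamma_k^I}[R_{\gamma k}^T\; D_{\gamma k}^T]\begin{bmatrix}T^{(1)}_{\gamma k}&T^{(3)}_{\gamma k}\\ T^{(2)}_{\gamma k}&T^{(4)}_{\gamma k}\end{bmatrix}\begin{bmatrix}R_{\gamma k}u_{h,k}-R_{\gamma v}u_{h,v}\\ D_{\gamma k}u_{h,k}+D_{\gamma v}u_{h,v}\end{bmatrix}+\sum_{\gamma\subset\Gamma_k^I}\Big\{\sum_{\epsilon}R_{\gamma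 k}^TT^{(5)}_{\gamma\epsilon k}[R_{\epsilon k}u_{h,k}-R_{\epsilon g}u_{h,g}]+\sum_{\delta}R_{\gamma k}^TT^{(6)}_{\gamma\delta v}[R_{\delta v}u_{h,v}-R_{\delta q}u_{h,q}]\Big\},$$ $$s_k^B=\sum_{\gamma\subset\Gamma^D\cap\Gamma_k}[R_{\gamma k}^T\; D_{\gamma k}^T]\begin{bmatrix}T_\gamma^{(D)}\\ -B_\gamma\end{bmatrix}(R_{\gamma k}u_{h,k}-u_{\gamma k})+\sum_{\gamma\subset\Gamma^N\cap\Gamma_k}R_{\gamma k}^TB_\gamma(D_{\gamma k}u_{h,k}-w_{\gamma k}),$$ where $f_k,u_{\gamma k},w_{\gamma k}$ are nodal values of $\mathcal F$ and of the Dirichlet and Neumann data (all zero in the homogeneous case). Standing assumption on coefficients: $T^{(1)},\dots,T^{(4)},T^{(D)}$ are symmetric. **Conservative** is understood through the coefficient conditions $T^{(1)}_{\gamma k}=T^{(1)}_{\gamma v}$, $T^{(3)}_{\gamma k}+T^{(3)}_{\gamma v}=B_\gamma$, $T^{(5)}_{abk}=-T^{(6)}_{abk}$. **Adjoint inconsistent** means that the additional conditions for adjoint consistency ($T^{(2)}_{\gamma k}+T^{(2)}_{\gamma v}=-B_\gamma$, $T^{(4)}_{\gamma k}=T^{(4)}_{\gamma v}$) are not all satisfied. **Energy stable** means $\frac{d}{dt}\sum_ku_{h,k}^TH_ku_{h,k}\le0$ for the semi-discrete solution. $Y\succeq0$ means $Y$ is positive semidefinite. *)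

theory Defs
  imports "HOL-Analysis.Analysis"
begin

definition sym_mat :: "real^'n^'n \<Rightarrow> bool" where
  "sym_mat A \<longleftrightarrow> transpose A = A"

definition diagonal_mat :: "real^'n^'n \<Rightarrow> bool" where
  "diagonal_mat A \<longleftrightarrow> (\<forall>i j. i \<noteq> j \<longrightarrow> A $ i $ j = 0)"

definition pos_semidef :: "real^'n^'n \<Rightarrow> bool" where
  "pos_semidef A \<longleftrightarrow> sym_mat A \<and> (\<forall>x. 0 \<le> x \<bullet> (A *v x))"

definition spd :: "real^'n^'n \<Rightarrow> bool" where
  "spd A \<longleftrightarrow> sym_mat A \<and> (\<forall>x. x \<noteq> 0 \<longrightarrow> 0 < x \<bullet> (A *v x))"

definition diag_mat :: "('n \<Rightarrow> real) \<Rightarrow> real^'n^'n" where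
  "diag_mat d = (\<chi> i j. if i = j then d i else 0)"

text \<open>Block vectors and matrices are indexed by sum types, so that for example the gradient
  of a grid function with nodes \<open>'p\<close> is a vector over \<open>'p + 'p\<close>.\<close>

definition vec_append :: "real^'a \<Rightarrow> real^'b \<Rightarrow> real^('a + 'b)" where
  "vec_append x y = (\<chi> i. case i of Inl a \<Rightarrow> x $ a | Inr b \<Rightarrow> y $ b)"

definition mat_over :: "real^'c^'a \<Rightarrow> real^'c^'b \<Rightarrow> real^'c^('a + 'b)" where
  "mat_over A B = (\<chi> i. case i of Inl a \<Rightarrow> A $ a | Inr b \<Rightarrow> B $ b)"

definition mat_beside :: "real^'a^'c \<Rightarrow> real^'b^'c \<Rightarrow> real^('a + 'b)^'c" where
  "mat_beside A B = (\<chi> i. vec_append (A $ i) (B $ i))"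

definition mat_block ::
  "real^'a^'c \<Rightarrow> real^'b^'c \<Rightarrow> real^'a^'d \<Rightarrow> real^'b^'d \<Rightarrow> real^('a + 'b)^('c + 'd)" where
  "mat_block A B C D = mat_over (mat_beside A B) (mat_beside C D)"

definition mat_twice :: "real^'a^'c \<Rightarrow> real^('a + 'a)^('c + 'c)" where
  "mat_twice A = mat_block A 0 0 A"

record problem =
  dom :: "(real^2) set"
  GammaD :: "(real^2) set"
  GammaN :: "(real^2) set"
  lam :: "real^2 \<Rightarrow> real^2^2"
  src :: "real \<Rightarrow> real^2 \<Rightarrow> real"
  dirichlet_data :: "real \<Rightarrow> real^2 \<Rightarrow> real"
  neumann_data :: "real \<Rightarrow> real^2 \<Rightarrow> real"

text \<open>Here and for the element maps below, smooth is read as \<open>C\<^sup>1\<close>; this is the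
  weakest reading of the hypothesis.\<close>

definition smooth_arc :: "(real \<Rightarrow> real^2) \<Rightarrow> bool" where
  "smooth_arc g \<longleftrightarrow> arc g \<and> g C1_differentiable_on {0..1} \<and>
     (\<forall>t\<in>{0..1}. vector_derivative g (at t) \<noteq> 0)"

definition piecewise_smooth_boundary :: "(real^2) set \<Rightarrow> bool" where
  "piecewise_smooth_boundary S \<longleftrightarrow>
     (\<exists>G. finite G \<and> (\<forall>g\<in>G. smooth_arc g) \<and> frontier S = (\<Union>g\<in>G. path_image g))"

definition diffusion_problem :: "problem \<Rightarrow> bool" where
  "diffusion_problem P \<longleftrightarrow>
     compact (dom P) \<and> piecewise_smooth_boundary (dom P) \<and>
     frontier (dom P) = GammaD P \<union> GammaN P \<and> GammaD P \<noteq> {} \<and>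
     (\<forall>x\<in>dom P. spd (lam P x))"

definition homogeneous :: "problem \<Rightarrow> bool" where
  "homogeneous P \<longleftrightarrow>
     (\<forall>t. (\<forall>x\<in>dom P. src P t x = 0) \<and> (\<forall>x\<in>GammaD P. dirichlet_data P t x = 0) \<and>
          (\<forall>x\<in>GammaN P. neumann_data P t x = 0))"

definition ref_vertices :: "(real^2) set" where
  "ref_vertices = {0, axis 1 1, axis 2 1}"

definition ref_triangle :: "(real^2) set" where
  "ref_triangle = convex hull ref_vertices"

definition triangle_map :: "(real^2 \<Rightarrow> real^2) \<Rightarrow> bool" where
  "triangle_map \<phi> \<longleftrightarrow> inj_on \<phi> ref_triangle \<and>
     (\<exists>J :: real^2 \<Rightarrow> real^2^2. continuous_on ref_triangle J \<and>
        (\<forall>\<xi>\<in>ref_triangle. (\<phi> has_derivative (\<lambda>h. J \<xi> *v h)) (at \<xi> within ref_triangle) \<and>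
           invertible (J \<xi>)))"

record 'k mesh =
  elems :: "'k set"
  elem_map :: "'k \<Rightarrow> real^2 \<Rightarrow> real^2"

definition element :: "'k mesh \<Rightarrow> 'k \<Rightarrow> (real^2) set" where
  "element M k = elem_map M k ` ref_triangle"

text \<open>A facet is the point set of a curved edge, so that the two elements adjacent to an
  interior facet have literally the same facet.\<close>

definition facets :: "'k mesh \<Rightarrow> 'k \<Rightarrow> (real^2) set set" where
  "facets M k = {elem_map M k ` closed_segment a b | a b.
     a \<in> ref_vertices \<and> b \<in> ref_vertices \<and> a \<noteq> b}"

definition interior_facets :: "'k mesh \<Rightarrow> 'k \<Rightarrow> (real^2) set set" where
  "interior_facets M k = {\<gamma> \<in> facets M k. \<exists>v\<in>elems M. v \<noteq> k \<and> \<gamma> \<in> facets M v}"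

definition dirichlet_facets :: "problem \<Rightarrow> 'k mesh \<Rightarrow> 'k \<Rightarrow> (real^2) set set" where
  "dirichlet_facets P M k = {\<gamma> \<in> facets M k. \<gamma> \<subseteq> GammaD P}"

definition neumann_facets :: "problem \<Rightarrow> 'k mesh \<Rightarrow> 'k \<Rightarrow> (real^2) set set" where
  "neumann_facets P M k = {\<gamma> \<in> facets M k. \<gamma> \<subseteq> GammaN P}"

definition adjacent :: "'k mesh \<Rightarrow> (real^2) set \<Rightarrow> 'k \<Rightarrow> 'k \<Rightarrow> bool" where
  "adjacent M \<gamma> k v \<longleftrightarrow> k \<in> elems M \<and> v \<in> elems M \<and> k \<noteq> v \<and> \<gamma> \<in> facets M k \<and> \<gamma> \<in> facets M v"

definition nbr :: "'k mesh \<Rightarrow> (real^2) set \<Rightarrow> 'k \<Rightarrow> 'k" where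
  "nbr M \<gamma> k = (THE v. adjacent M \<gamma> k v)"

text \<open>The last condition says that every facet is exactly one of: shared with exactly one other
  element, contained in the Dirichlet boundary, contained in the Neumann boundary.\<close>

definition mesh_of :: "problem \<Rightarrow> 'k mesh \<Rightarrow> bool" where
  "mesh_of P M \<longleftrightarrow>
     finite (elems M) \<and> (\<forall>k\<in>elems M. triangle_map (elem_map M k)) \<and>
     dom P = (\<Union>k\<in>elems M. element M k) \<and>
     (\<forall>k\<in>elems M. \<forall>v\<in>elems M. k \<noteq> v \<longrightarrow> interior (element M k) \<inter> interior (element M v) = {}) \<and>
     (\<forall>k\<in>elems M. \<forall>\<gamma>\<in>facets M k.
        ((\<exists>!v. adjacent M \<gamma> k v) \<and> \<not> \<gamma> \<subseteq> GammaD P \<and> \<not> \<gamma> \<subseteq> GammaN P) \<or>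
        ((\<nexists>v. adjacent M \<gamma> k v) \<and> (\<gamma> \<subseteq> GammaD P \<longleftrightarrow> \<not> \<gamma> \<subseteq> GammaN P)))"

text \<open>The normal \<open>n\<close> at the point \<open>x\<close> of a curved edge: \<open>A\<close> maps the direction \<open>b - a\<close> of the
  reference edge to a tangent of the facet, and the direction \<open>c - \<xi>\<close> towards the opposite vertex
  to one pointing into the element.  At a corner of the element the normal depends on the facet.\<close>

definition outward_unit_normal ::
  "'k mesh \<Rightarrow> (real^2) set \<Rightarrow> 'k \<Rightarrow> real^2 \<Rightarrow> real^2 \<Rightarrow> bool" where
  "outward_unit_normal M \<gamma> k x n \<longleftrightarrow> norm n = 1 \<and>
     (\<exists>a b c \<xi> A. {a, b, c} = ref_vertices \<and> \<gamma> = elem_map M k ` closed_segment a b \<and>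
        \<xi> \<in> closed_segment a b \<and> x = elem_map M k \<xi> \<and>
        (elem_map M k has_derivative A) (at \<xi> within ref_triangle) \<and>
        n \<bullet> A (b - a) = 0 \<and> n \<bullet> A (c - \<xi>) < 0)"

text \<open>\<open>'p\<close> indexes the volume nodes of an element and \<open>'f\<close> the nodes of a facet.  Facet nodes and
  facet weights do not depend on the element from which the facet is seen.\<close>

record ('k, 'p, 'f) sbp =
  vol_node :: "'k \<Rightarrow> 'p \<Rightarrow> real^2"
  facet_node :: "(real^2) set \<Rightarrow> 'f \<Rightarrow> real^2"
  normal :: "(real^2) set \<Rightarrow> 'k \<Rightarrow> 'f \<Rightarrow> real^2"
  Hmat :: "'k \<Rightarrow> real^'p^'p"
  Dxmat :: "'k \<Rightarrow> real^'p^'p"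
  Dymat :: "'k \<Rightarrow> real^'p^'p"
  Bmat :: "(real^2) set \<Rightarrow> real^'f^'f"
  Rmat :: "(real^2) set \<Rightarrow> 'k \<Rightarrow> real^'p^'f"
  weight :: "(real^2) set \<Rightarrow> 'k \<Rightarrow> real"

definition Nx :: "('k, 'p::finite, 'f::finite) sbp \<Rightarrow> (real^2) set \<Rightarrow> 'k \<Rightarrow> real^'f^'f" where
  "Nx S \<gamma> k = diag_mat (\<lambda>j. normal S \<gamma> k j $ 1)"

definition Ny :: "('k, 'p::finite, 'f::finite) sbp \<Rightarrow> (real^2) set \<Rightarrow> 'k \<Rightarrow> real^'f^'f" where
  "Ny S \<gamma> k = diag_mat (\<lambda>j. normal S \<gamma> k j $ 2)"

definition sbp_operators ::
  "'k mesh \<Rightarrow> ('k, 'p::finite, 'f::finite) sbp \<Rightarrow> bool" where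
  "sbp_operators M S \<longleftrightarrow> (\<forall>k\<in>elems M.
     (\<forall>i. vol_node S k i \<in> element M k) \<and>
     diagonal_mat (Hmat S k) \<and> spd (Hmat S k) \<and>
     (\<forall>\<gamma>\<in>facets M k.
        (\<forall>j. facet_node S \<gamma> j \<in> \<gamma> \<and>
             outward_unit_normal M \<gamma> k (facet_node S \<gamma> j) (normal S \<gamma> k j)) \<and>
        diagonal_mat (Bmat S \<gamma>) \<and> (\<forall>j. 0 < Bmat S \<gamma> $ j $ j) \<and> 0 < weight S \<gamma> k) \<and>
     (\<Sum>\<gamma>\<in>facets M k. weight S \<gamma> k) = 1 \<and>
     Hmat S k ** Dxmat S k + transpose (Hmat S k ** Dxmat S k) =
       (\<Sum>\<gamma>\<in>facets M k. transpose (Rmat S \<gamma> k) ** Bmat S \<gamma> ** Nx S \<gamma> k ** Rmat S \<gamma> k) \<and>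
     Hmat S k ** Dymat S k + transpose (Hmat S k ** Dymat S k) =
       (\<Sum>\<gamma>\<in>facets M k. transpose (Rmat S \<gamma> k) ** Bmat S \<gamma> ** Ny S \<gamma> k ** Rmat S \<gamma> k))"

definition Nmat :: "('k, 'p::finite, 'f::finite) sbp \<Rightarrow> (real^2) set \<Rightarrow> 'k \<Rightarrow> real^'f^('f + 'f)" where
  "Nmat S \<gamma> k = mat_over (Nx S \<gamma> k) (Ny S \<gamma> k)"

definition Rbar ::
  "('k, 'p::finite, 'f::finite) sbp \<Rightarrow> (real^2) set \<Rightarrow> 'k \<Rightarrow> real^('p + 'p)^('f + 'f)" where
  "Rbar S \<gamma> k = mat_twice (Rmat S \<gamma> k)"

definition Hbar :: "('k, 'p::finite, 'f::finite) sbp \<Rightarrow> 'k \<Rightarrow> real^('p + 'p)^('p + 'p)" where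
  "Hbar S k = mat_twice (Hmat S k)"

definition Lambda ::
  "problem \<Rightarrow> ('k, 'p::finite, 'f::finite) sbp \<Rightarrow> 'k \<Rightarrow> real^('p + 'p)^('p + 'p)" where
  "Lambda P S k =
     (let L = (\<lambda>a b. diag_mat (\<lambda>i. lam P (vol_node S k i) $ a $ b))
      in mat_block (L 1 1) (L 1 2) (L 2 1) (L 2 2))"

definition D2 :: "problem \<Rightarrow> ('k, 'p::finite, 'f::finite) sbp \<Rightarrow> 'k \<Rightarrow> real^'p^'p" where
  "D2 P S k = mat_beside (Dxmat S k) (Dymat S k) ** Lambda P S k ** mat_over (Dxmat S k) (Dymat S k)"

definition Dfacet ::
  "problem \<Rightarrow> ('k, 'p::finite, 'f::finite) sbp \<Rightarrow> (real^2) set \<Rightarrow> 'k \<Rightarrow> real^'p^'f" where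
  "Dfacet P S \<gamma> k = transpose (Nmat S \<gamma> k) ** Rbar S \<gamma> k ** Lambda P S k
     ** mat_over (Dxmat S k) (Dymat S k)"

definition Upsilon ::
  "problem \<Rightarrow> ('k, 'p::finite, 'f::finite) sbp \<Rightarrow> (real^2) set \<Rightarrow> (real^2) set \<Rightarrow> 'k \<Rightarrow> real^'f^'f" where
  "Upsilon P S a b k = transpose (Nmat S a k) ** Rbar S a k ** matrix_inv (Hbar S k) ** Lambda P S k
     ** transpose (Rbar S b k) ** Nmat S b k"

record ('k, 'f) sat =
  T1 :: "(real^2) set \<Rightarrow> 'k \<Rightarrow> real^'f^'f"
  T2 :: "(real^2) set \<Rightarrow> 'k \<Rightarrow> real^'f^'f"
  T3 :: "(real^2) set \<Rightarrow> 'k \<Rightarrow> real^'f^'f"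
  T4 :: "(real^2) set \<Rightarrow> 'k \<Rightarrow> real^'f^'f"
  T5 :: "(real^2) set \<Rightarrow> (real^2) set \<Rightarrow> 'k \<Rightarrow> real^'f^'f"
  T6 :: "(real^2) set \<Rightarrow> (real^2) set \<Rightarrow> 'k \<Rightarrow> real^'f^'f"
  TD :: "(real^2) set \<Rightarrow> real^'f^'f"

definition sat_symmetric :: "problem \<Rightarrow> 'k mesh \<Rightarrow> ('k, 'f::finite) sat \<Rightarrow> bool" where
  "sat_symmetric P M C \<longleftrightarrow> (\<forall>k\<in>elems M.
     (\<forall>\<gamma>\<in>interior_facets M k. sym_mat (T1 C \<gamma> k) \<and> sym_mat (T2 C \<gamma> k) \<and>
        sym_mat (T3 C \<gamma> k) \<and> sym_mat (T4 C \<gamma> k)) \<and>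
     (\<forall>\<gamma>\<in>dirichlet_facets P M k. sym_mat (TD C \<gamma>)))"

definition jump :: "'k mesh \<Rightarrow> ('k, 'p::finite, 'f::finite) sbp \<Rightarrow> ('k \<Rightarrow> real^'p) \<Rightarrow>
    (real^2) set \<Rightarrow> 'k \<Rightarrow> real^'f" where
  "jump M S u \<gamma> k = Rmat S \<gamma> k *v u k - Rmat S \<gamma> (nbr M \<gamma> k) *v u (nbr M \<gamma> k)"

definition flux_sum :: "problem \<Rightarrow> 'k mesh \<Rightarrow> ('k, 'p::finite, 'f::finite) sbp \<Rightarrow> ('k \<Rightarrow> real^'p) \<Rightarrow>
    (real^2) set \<Rightarrow> 'k \<Rightarrow> real^'f" where
  "flux_sum P M S u \<gamma> k =
     Dfacet P S \<gamma> k *v u k + Dfacet P S \<gamma> (nbr M \<gamma> k) *v u (nbr M \<gamma> k)"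

definition sat_interior :: "problem \<Rightarrow> 'k mesh \<Rightarrow> ('k, 'p::finite, 'f::finite) sbp \<Rightarrow>
    ('k, 'f) sat \<Rightarrow> ('k \<Rightarrow> real^'p) \<Rightarrow> 'k \<Rightarrow> real^'p" where
  "sat_interior P M S C u k =
     (\<Sum>\<gamma>\<in>interior_facets M k.
        (mat_beside (transpose (Rmat S \<gamma> k)) (transpose (Dfacet P S \<gamma> k))
           ** mat_block (T1 C \<gamma> k) (T3 C \<gamma> k) (T2 C \<gamma> k) (T4 C \<gamma> k))
        *v vec_append (jump M S u \<gamma> k) (flux_sum P M S u \<gamma> k)) +
     (\<Sum>\<gamma>\<in>interior_facets M k. let v = nbr M \<gamma> k in
        (\<Sum>\<epsilon>\<in>interior_facets M k - {\<gamma>}.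
           (transpose (Rmat S \<gamma> k) ** T5 C \<gamma> \<epsilon> k) *v jump M S u \<epsilon> k) +
        (\<Sum>\<delta>\<in>interior_facets M v - {\<gamma>}.
           (transpose (Rmat S \<gamma> k) ** T6 C \<gamma> \<delta> v) *v jump M S u \<delta> v))"

definition sat_boundary :: "problem \<Rightarrow> 'k mesh \<Rightarrow> ('k, 'p::finite, 'f::finite) sbp \<Rightarrow>
    ('k, 'f) sat \<Rightarrow> real \<Rightarrow> ('k \<Rightarrow> real^'p) \<Rightarrow> 'k \<Rightarrow> real^'p" where
  "sat_boundary P M S C t u k =
     (\<Sum>\<gamma>\<in>dirichlet_facets P M k.
        (mat_beside (transpose (Rmat S \<gamma> k)) (transpose (Dfacet P S \<gamma> k))
           ** mat_over (TD C \<gamma>) (- Bmat S \<gamma>))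
        *v (Rmat S \<gamma> k *v u k - (\<chi> j. dirichlet_data P t (facet_node S \<gamma> j)))) +
     (\<Sum>\<gamma>\<in>neumann_facets P M k.
        (transpose (Rmat S \<gamma> k) ** Bmat S \<gamma>)
        *v (Dfacet P S \<gamma> k *v u k - (\<chi> j. neumann_data P t (facet_node S \<gamma> j))))"

definition semidiscrete_rhs :: "problem \<Rightarrow> 'k mesh \<Rightarrow> ('k, 'p::finite, 'f::finite) sbp \<Rightarrow>
    ('k, 'f) sat \<Rightarrow> real \<Rightarrow> ('k \<Rightarrow> real^'p) \<Rightarrow> 'k \<Rightarrow> real^'p" where
  "semidiscrete_rhs P M S C t u k =
     D2 P S k *v u k + (\<chi> i. src P t (vol_node S k i))
     - matrix_inv (Hmat S k) *v sat_interior P M S C u k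
     - matrix_inv (Hmat S k) *v sat_boundary P M S C t u k"

definition semidiscrete_solution :: "problem \<Rightarrow> 'k mesh \<Rightarrow> ('k, 'p::finite, 'f::finite) sbp \<Rightarrow>
    ('k, 'f) sat \<Rightarrow> real \<Rightarrow> (real \<Rightarrow> 'k \<Rightarrow> real^'p) \<Rightarrow> bool" where
  "semidiscrete_solution P M S C tf u \<longleftrightarrow>
     (\<forall>t\<in>{0..tf}. \<forall>k\<in>elems M.
        ((\<lambda>s. u s k) has_vector_derivative semidiscrete_rhs P M S C t (u t) k) (at t within {0..tf}))"

definition energy :: "'k mesh \<Rightarrow> ('k \<Rightarrow> real^'p^'p) \<Rightarrow> ('k \<Rightarrow> real^'p) \<Rightarrow> real" where
  "energy M H u = (\<Sum>k\<in>elems M. u k \<bullet> (H k *v u k))"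

definition energy_stable :: "problem \<Rightarrow> 'k mesh \<Rightarrow> ('k, 'p::finite, 'f::finite) sbp \<Rightarrow>
    ('k, 'f) sat \<Rightarrow> ('k \<Rightarrow> real^'p^'p) \<Rightarrow> bool" where
  "energy_stable P M S C H \<longleftrightarrow>
     (\<forall>tf u. 0 < tf \<longrightarrow> semidiscrete_solution P M S C tf u \<longrightarrow>
        (\<forall>t\<in>{0..tf}. \<exists>d \<le> 0.
           ((\<lambda>s. energy M H (u s)) has_real_derivative d) (at t within {0..tf})))"

definition sbp_sat_discretization ::
  "problem \<Rightarrow> 'k mesh \<Rightarrow> ('k, 'p::finite, 'f::finite) sbp \<Rightarrow> ('k, 'f) sat \<Rightarrow> bool" where
  "sbp_sat_discretization P M S C \<longleftrightarrow>
     diffusion_problem P \<and> mesh_of P M \<and> sbp_operators M S \<and> sat_symmetric P M C"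

definition conservative ::
  "'k mesh \<Rightarrow> ('k, 'p::finite, 'f::finite) sbp \<Rightarrow> ('k, 'f) sat \<Rightarrow> bool" where
  "conservative M S C \<longleftrightarrow>
     (\<forall>\<gamma> k v. adjacent M \<gamma> k v \<longrightarrow>
        T1 C \<gamma> k = T1 C \<gamma> v \<and> T3 C \<gamma> k + T3 C \<gamma> v = Bmat S \<gamma>) \<and>
     (\<forall>k\<in>elems M. \<forall>a\<in>interior_facets M k. \<forall>b\<in>interior_facets M k - {a}.
        T5 C a b k = - T6 C a b k)"

definition adjoint_conditions ::
  "'k mesh \<Rightarrow> ('k, 'p::finite, 'f::finite) sbp \<Rightarrow> ('k, 'f) sat \<Rightarrow> bool" where
  "adjoint_conditions M S C \<longleftrightarrow>
     (\<forall>\<gamma> k v. adjacent M \<gamma> k v \<longrightarrow>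
        T2 C \<gamma> k + T2 C \<gamma> v = - Bmat S \<gamma> \<and> T4 C \<gamma> k = T4 C \<gamma> v)"

end

theory Submission
  imports Defs
begin

text \<open>By summation by parts, the energy rate of an element is the sum over its facets of
  \<open>(R u) \<bullet> B (D u)\<close>, minus the dissipation \<open>g \<bullet> H \<Lambda> g\<close> of the discrete gradient \<open>g\<close>, minus the
  penalty terms.  On an interior facet the conditions on \<open>T2\<close> and \<open>T3\<close> make the mixed penalty terms
  cancel the volume contributions of the two sides, so that only the nonpositive terms of \<open>T1\<close> and
  \<open>T4\<close> survive.  The Neumann penalty cancels the volume contribution.  On a Dirichlet facet
  \<open>2 (R u) \<bullet> B (D u)\<close> is absorbed by \<open>TD\<close> and the fraction \<open>\<alpha>\<close> of the dissipation; since the \<open>\<alpha>\<close>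
  of the facets of an element add up to 1, the dissipation suffices.\<close>

section \<open>Block matrices\<close>

lemma sum_mat_vec_mult: "(\<Sum>i\<in>I. A i) *v x = (\<Sum>i\<in>I. A i *v x)"
  for A :: "'i \<Rightarrow> real^'n^'m"
  by (induction I rule: infinite_finite_induct) (auto simp: matrix_vector_mult_add_rdistrib)

text \<open>All adjoint arguments go through this rule. The simp rule
  \<open>transpose_matrix_vector\<close> would turn its left side into a \<open>v*\<close> product,
  so simp calls that rewrite with it delete that rule.\<close>

lemma inner_transpose_mult: "x \<bullet> (transpose A *v y) = (A *v x) \<bullet> y"
  for A :: "real^'n^'m"
  by (metis dot_lmul_matrix inner_commute transpose_matrix_vector)

lemma sym_mat_inner: "sym_mat A \<Longrightarrow> x \<bullet> (A *v y) = y \<bullet> (A *v x)"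
  by (metis inner_commute inner_transpose_mult sym_mat_def)

lemma vec_append_cases: obtains x y where "z = vec_append x y"
proof
  show "z = vec_append (\<chi> i. z $ Inl i) (\<chi> i. z $ Inr i)"
    by (auto simp: vec_append_def vec_eq_iff split: sum.split)
qed

lemma inner_vec_append: "vec_append x y \<bullet> vec_append x' y' = x \<bullet> x' + y \<bullet> y'"
  for x :: "real^'a::finite" and y :: "real^'b::finite"
  by (simp add: inner_vec_def vec_append_def sum.Plus flip: UNIV_Plus_UNIV)

lemma vec_append_eq_iff: "vec_append x y = vec_append x' y' \<longleftrightarrow> x = x' \<and> y = y'"
  by (simp add: vec_append_def vec_eq_iff split_sum_all)

lemma mat_over_mult: "mat_over A B *v x = vec_append (A *v x) (B *v x)"
  by (auto simp: mat_over_def vec_append_def matrix_vector_mult_def vec_eq_iff split: sum.split)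

lemma mat_beside_mult: "mat_beside A B *v vec_append x y = A *v x + B *v y"
  for A :: "real^'a::finite^'c" and B :: "real^'b::finite^'c"
  using inner_vec_append[of "A $ i" "B $ i" x y for i]
  by (auto simp: mat_beside_def matrix_vector_mul_component vec_eq_iff)

lemma mat_block_mult:
  "mat_block A B C D *v vec_append x y = vec_append (A *v x + B *v y) (C *v x + D *v y)"
  by (simp add: mat_block_def mat_over_mult mat_beside_mult)

lemma mat_twice_mult: "mat_twice A *v vec_append x y = vec_append (A *v x) (A *v y)"
  by (simp add: mat_twice_def mat_block_mult)

lemma transpose_mat_over_mult:
  "transpose (mat_over A B) *v vec_append x y = transpose A *v x + transpose B *v y"
proof -
  have "z \<bullet> (transpose (mat_over A B) *v vec_append x y) =
      z \<bullet> (transpose A *v x + transpose B *v y)" for z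
    unfolding inner_add_right inner_transpose_mult mat_over_mult inner_vec_append ..
  then show ?thesis
    using vector_eq_ldot by blast
qed

section \<open>Diagonal, positive definite and invertible matrices\<close>

lemma diag_mat_mult: "diag_mat d *v x = (\<chi> i. d i * x $ i)"
  by (simp add: diag_mat_def matrix_vector_mult_def vec_eq_iff if_distrib if_distribR cong: if_cong)

lemma sym_mat_diag_mat: "sym_mat (diag_mat d)"
  by (auto simp: sym_mat_def diag_mat_def transpose_def vec_eq_iff)

lemma diagonal_mat_eq: "diagonal_mat A \<Longrightarrow> A = diag_mat (\<lambda>i. A $ i $ i)"
  by (auto simp: diagonal_mat_def diag_mat_def vec_eq_iff)

lemma sym_mat_diagonal: "diagonal_mat A \<Longrightarrow> sym_mat A"
  by (metis diagonal_mat_eq sym_mat_diag_mat)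

lemma spd_diagonal_entry: "spd A \<Longrightarrow> 0 < A $ i $ i"
proof -
  assume "spd A"
  moreover have "axis i (1::real) \<noteq> 0"
    by simp
  ultimately have "0 < axis i 1 \<bullet> (A *v axis i 1)"
    unfolding spd_def by blast
  then show ?thesis
    by (simp add: inner_axis' matrix_vector_mul_component inner_axis)
qed

lemma spd_invertible: "spd A \<Longrightarrow> invertible A"
  by (metis inner_zero_right invertible_left_inverse less_irrefl matrix_left_invertible_ker spd_def)

lemma matrix_inv_inverse:
  assumes "invertible A"
  shows "A ** matrix_inv A = mat 1" "matrix_inv A ** A = mat 1"
  using someI_ex[OF assms[unfolded invertible_def]] by (auto simp: matrix_inv_def)

lemma invertible_mult_inv: "invertible A \<Longrightarrow> A *v (matrix_inv A *v x) = x"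
  by (simp add: matrix_vector_mul_assoc matrix_inv_inverse)

lemma invertible_inv_mult: "invertible A \<Longrightarrow> matrix_inv A *v (A *v x) = x"
  by (simp add: matrix_vector_mul_assoc matrix_inv_inverse)

lemma inner_matrix_inv:
  assumes "sym_mat A" "invertible A"
  shows "x \<bullet> (matrix_inv A *v y) = y \<bullet> (matrix_inv A *v x)"
  using sym_mat_inner[OF assms(1), of "matrix_inv A *v x" "matrix_inv A *v y"]
  by (simp add: invertible_mult_inv[OF assms(2)] inner_commute)

text \<open>Young's inequality for the semidefinite form of \<open>G L\<close>: evaluate the form at
  \<open>\<alpha> g - z\<close>, where \<open>G z = w\<close>, expand and divide by \<alpha>.
  Because \<open>G\<close> and \<open>L\<close> are symmetric and commute, both mixed terms equal
  \<open>w \<bullet> (L *v g)\<close>.\<close>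

lemma weighted_cauchy_schwarz:
  assumes G: "sym_mat G" "invertible G" and L: "sym_mat L"
    and comm: "\<And>x. G *v (L *v x) = L *v (G *v x)"
    and nonneg: "\<And>x. 0 \<le> x \<bullet> (G *v (L *v x))"
    and "0 < \<alpha>"
  shows "2 * (w \<bullet> (L *v g)) \<le> (1 / \<alpha>) * (w \<bullet> (matrix_inv G *v (L *v w))) + \<alpha> * (g \<bullet> (G *v (L *v g)))"
proof -
  define z where "z = matrix_inv G *v w"
  have Gz: "G *v z = w"
    by (simp add: z_def G invertible_mult_inv)
  have zz: "z \<bullet> (G *v (L *v z)) = w \<bullet> (matrix_inv G *v (L *v w))"
    using inner_matrix_inv[OF G, of w "L *v w"] by (simp add: comm Gz) (simp add: z_def inner_commute)
  have gz: "g \<bullet> (G *v (L *v z)) = w \<bullet> (L *v g)"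
    using sym_mat_inner[OF L] by (simp add: comm Gz)
  have zg: "z \<bullet> (G *v (L *v g)) = w \<bullet> (L *v g)"
    using sym_mat_inner[OF G(1)] Gz by (metis inner_commute)
  have "0 \<le> (\<alpha> *\<^sub>R g - z) \<bullet> (G *v (L *v (\<alpha> *\<^sub>R g - z)))"
    by (rule nonneg)
  also have "\<dots> = \<alpha>\<^sup>2 * (g \<bullet> (G *v (L *v g))) - 2 * \<alpha> * (w \<bullet> (L *v g))
      + w \<bullet> (matrix_inv G *v (L *v w))"
    by (simp add: matrix_vector_mult_diff_distrib matrix_vector_mult_scaleR inner_diff_left
        inner_diff_right zz gz zg power2_eq_square algebra_simps)
  finally show ?thesis
    using \<open>0 < \<alpha>\<close> by (simp add: field_simps power2_eq_square)
qed

section \<open>Mesh\<close>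

lemma finite_facets: "finite (facets M k)"
proof -
  have "facets M k \<subseteq> (\<lambda>(a, b). elem_map M k ` closed_segment a b) ` (ref_vertices \<times> ref_vertices)"
    by (auto simp: facets_def)
  moreover have "finite (ref_vertices \<times> ref_vertices)"
    by (simp add: ref_vertices_def)
  ultimately show ?thesis
    by (rule finite_surj[rotated])
qed

lemma adjacent_commute: "adjacent M \<gamma> k v \<longleftrightarrow> adjacent M \<gamma> v k"
  by (auto simp: adjacent_def)

lemma interior_facet_iff:
  "k \<in> elems M \<Longrightarrow> \<gamma> \<in> interior_facets M k \<longleftrightarrow> (\<exists>v. adjacent M \<gamma> k v)"
  by (auto simp: interior_facets_def adjacent_def)

lemma mesh_facet:
  assumes "mesh_of P M" "k \<in> elems M" "\<gamma> \<in> facets M k"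
  shows "((\<exists>!v. adjacent M \<gamma> k v) \<and> \<not> \<gamma> \<subseteq> GammaD P \<and> \<not> \<gamma> \<subseteq> GammaN P) \<or>
    ((\<nexists>v. adjacent M \<gamma> k v) \<and> (\<gamma> \<subseteq> GammaD P \<longleftrightarrow> \<not> \<gamma> \<subseteq> GammaN P))"
  using assms(1)[unfolded mesh_of_def, THEN conjunct2, THEN conjunct2, THEN conjunct2,
      THEN conjunct2] assms(2,3) by simp

lemma ex1_adjacent:
  assumes "mesh_of P M" "adjacent M \<gamma> k v"
  shows "\<exists>!v. adjacent M \<gamma> k v"
proof -
  have "k \<in> elems M" "\<gamma> \<in> facets M k"
    using assms(2) by (simp_all add: adjacent_def)
  then show ?thesis
    using mesh_facet[OF assms(1)] assms(2) by metis
qed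

lemma nbr_eq:
  assumes "mesh_of P M" "adjacent M \<gamma> k v"
  shows "nbr M \<gamma> k = v"
  unfolding nbr_def by (rule the1_equality) (use ex1_adjacent[OF assms] assms in simp_all)

lemma adjacent_nbr:
  assumes "mesh_of P M" "k \<in> elems M" "\<gamma> \<in> interior_facets M k"
  shows "adjacent M \<gamma> k (nbr M \<gamma> k)"
proof -
  obtain v where "adjacent M \<gamma> k v"
    using assms(3) interior_facet_iff[OF assms(2)] by auto
  with assms(1) show ?thesis
    by (simp add: nbr_eq)
qed

text \<open>Turns the trichotomy in \<open>mesh_of\<close> into a disjoint splitting of the index
  set, so that the facet sum from summation by parts can be matched with the three penalty
  sums.\<close>

lemma facets_partition:
  assumes "mesh_of P M" "k \<in> elems M"
  shows "facets M k = interior_facets M k \<union> (dirichlet_facets P M k \<union> neumann_facets P M k)"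
    and "interior_facets M k \<inter> (dirichlet_facets P M k \<union> neumann_facets P M k) = {}"
    and "dirichlet_facets P M k \<inter> neumann_facets P M k = {}"
proof -
  let ?A = "{\<gamma>. \<exists>v. adjacent M \<gamma> k v}"
  let ?D = "{\<gamma>. \<gamma> \<subseteq> GammaD P}" and ?N = "{\<gamma>. \<gamma> \<subseteq> GammaN P}"
  have facet: "\<gamma> \<in> ?A \<and> \<gamma> \<notin> ?D \<and> \<gamma> \<notin> ?N \<or> \<gamma> \<notin> ?A \<and> (\<gamma> \<in> ?D \<longleftrightarrow> \<gamma> \<notin> ?N)"
    if "\<gamma> \<in> facets M k" for \<gamma>
    using mesh_facet[OF assms that] by auto
  have "interior_facets M k = facets M k \<inter> ?A"
    using interior_facet_iff[OF assms(2)] by (auto simp: interior_facets_def)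
  moreover have "dirichlet_facets P M k = facets M k \<inter> ?D" "neumann_facets P M k = facets M k \<inter> ?N"
    by (auto simp: dirichlet_facets_def neumann_facets_def)
  \<comment> \<open>Pure set algebra: adjacency and containment in the boundary parts are abstracted
    to arbitrary sets \<open>A\<close>, \<open>D\<close>, \<open>N\<close> before the automation is
    called.\<close>
  moreover have "F = F \<inter> A \<union> (F \<inter> D \<union> F \<inter> N) \<and> F \<inter> A \<inter> (F \<inter> D \<union> F \<inter> N) = {} \<and>
      F \<inter> D \<inter> (F \<inter> N) = {}"
    if "\<And>\<gamma>. \<gamma> \<in> F \<Longrightarrow> \<gamma> \<in> A \<and> \<gamma> \<notin> D \<and> \<gamma> \<notin> N \<or> \<gamma> \<notin> A \<and> (\<gamma> \<in> D \<longleftrightarrow> \<gamma> \<notin> N)"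
    for F A D N :: "(real^2) set set"
    using that by blast
  from this[of "facets M k" ?A ?D ?N, OF facet] calculation
  show "facets M k = interior_facets M k \<union> (dirichlet_facets P M k \<union> neumann_facets P M k)"
    "interior_facets M k \<inter> (dirichlet_facets P M k \<union> neumann_facets P M k) = {}"
    "dirichlet_facets P M k \<inter> neumann_facets P M k = {}"
    by simp_all
qed

lemma sum_facets:
  fixes f :: "(real^2) set \<Rightarrow> real"
  assumes "mesh_of P M" "k \<in> elems M"
  shows "(\<Sum>\<gamma>\<in>facets M k. f \<gamma>) = (\<Sum>\<gamma>\<in>interior_facets M k. f \<gamma>)
    + (\<Sum>\<gamma>\<in>dirichlet_facets P M k. f \<gamma>) + (\<Sum>\<gamma>\<in>neumann_facets P M k. f \<gamma>)"
proof -
  note part = facets_partition[OF assms]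
  have "finite (interior_facets M k)" "finite (dirichlet_facets P M k)"
    "finite (neumann_facets P M k)"
    using finite_facets[of M k] unfolding part(1) by simp_all
  then show ?thesis
    unfolding part(1) by (simp add: sum.union_disjoint part(2,3))
qed

text \<open>The double sum meets every interior facet once from each side. Exchanging the sides
  permutes the index pairs, so twice the sum is a sum of terms bounded by
  \<open>pair\<close>.\<close>

lemma sum_interior_facets_nonpos:
  fixes f :: "'k \<Rightarrow> (real^2) set \<Rightarrow> real"
  assumes mesh: "mesh_of P M"
    and pair: "\<And>\<gamma> k v. adjacent M \<gamma> k v \<Longrightarrow> f k \<gamma> + f v \<gamma> \<le> 0"
  shows "(\<Sum>k\<in>elems M. \<Sum>\<gamma>\<in>interior_facets M k. f k \<gamma>) \<le> 0"
proof -
  have fin: "finite (elems M)" "\<And>k. finite (interior_facets M k)"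
    using mesh finite_facets[of M] by (simp_all add: mesh_of_def interior_facets_def)
  let ?I = "SIGMA k:elems M. interior_facets M k"
  let ?n = "\<lambda>(k, \<gamma>). (nbr M \<gamma> k, \<gamma>)"
  have adj: "adjacent M \<gamma> k (nbr M \<gamma> k)" if "(k, \<gamma>) \<in> ?I" for k \<gamma>
    using that adjacent_nbr[OF mesh, of k \<gamma>] by simp
  \<comment> \<open>Since the neighbour across a facet is unique, crossing it twice leads back:
    \<open>?n\<close> is an involution of \<open>?I\<close>, and thus serves as both maps in the
    reindexing below.\<close>
  have n: "?n x \<in> ?I" "?n (?n x) = x" if x: "x \<in> ?I" for x
  proof -
    obtain k \<gamma> where x_eq: "x = (k, \<gamma>)" by force
    have a: "adjacent M \<gamma> (nbr M \<gamma> k) k"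
      using adj[of k \<gamma>] x adjacent_commute[of M \<gamma> k] by (simp add: x_eq)
    then have v: "nbr M \<gamma> k \<in> elems M"
      by (simp add: adjacent_def)
    then show "?n x \<in> ?I"
      using a interior_facet_iff[OF v, of \<gamma>] by (auto simp: x_eq)
    show "?n (?n x) = x"
      using nbr_eq[OF mesh a] by (simp add: x_eq)
  qed
  have swap: "(\<Sum>(k, \<gamma>)\<in>?I. f k \<gamma>) = (\<Sum>(k, \<gamma>)\<in>?I. f (nbr M \<gamma> k) \<gamma>)"
    by (rule sum.reindex_bij_witness[where i = ?n and j = ?n]) (use n in force)+
  have "(\<Sum>(k, \<gamma>)\<in>?I. f k \<gamma>) + (\<Sum>(k, \<gamma>)\<in>?I. f (nbr M \<gamma> k) \<gamma>)
      = (\<Sum>(k, \<gamma>)\<in>?I. f k \<gamma> + f (nbr M \<gamma> k) \<gamma>)"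
    by (simp add: sum.distrib[symmetric] case_prod_unfold)
  also have "\<dots> \<le> 0"
    by (rule sum_nonpos) (use pair adj in auto)
  finally have "(\<Sum>(k, \<gamma>)\<in>?I. f k \<gamma>) \<le> 0"
    using swap by linarith
  then show ?thesis
    using fin by (simp add: sum.Sigma)
qed

section \<open>Energy estimate on an element\<close>

lemma Lambda_mult:
  "Lambda P S k *v vec_append x y = vec_append
     (\<chi> i. lam P (vol_node S k i) $ 1 $ 1 * x $ i + lam P (vol_node S k i) $ 1 $ 2 * y $ i)
     (\<chi> i. lam P (vol_node S k i) $ 2 $ 1 * x $ i + lam P (vol_node S k i) $ 2 $ 2 * y $ i)"
  by (simp add: Lambda_def Let_def mat_block_mult diag_mat_mult plus_vec_def)

lemma Hbar_mult: "Hbar S k *v vec_append x y = vec_append (Hmat S k *v x) (Hmat S k *v y)"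
  by (simp add: Hbar_def mat_twice_mult)

text \<open>Symmetry is tested by inner products because the block matrices are handled through
  their action on appended vectors rather than entry by entry.\<close>

lemma sym_matI:
  assumes "\<And>x y. x \<bullet> (A *v y) = y \<bullet> (A *v x)"
  shows "sym_mat (A :: real^'n^'n)"
proof -
  have "y \<bullet> (transpose A *v x) = y \<bullet> (A *v x)" for x y
    using assms[of x y] unfolding inner_transpose_mult by (simp add: inner_commute)
  then have "transpose A *v x = A *v x" for x
    by (metis vector_eq_ldot)
  then show ?thesis
    unfolding sym_mat_def by (simp add: matrix_eq)
qed

lemma sym_mat_Hbar:
  assumes "sym_mat (Hmat S k)"
  shows "sym_mat (Hbar S k)"
proof (rule sym_matI)
  fix x y
  show "x \<bullet> (Hbar S k *v y) = y \<bullet> (Hbar S k *v x)"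
  proof (cases x rule: vec_append_cases, cases y rule: vec_append_cases)
    fix a b c d
    assume "x = vec_append a b" "y = vec_append c d"
    then show ?thesis
      using sym_mat_inner[OF assms, of a c] sym_mat_inner[OF assms, of b d]
      by (simp add: Hbar_mult inner_vec_append)
  qed
qed

lemma invertible_Hbar:
  fixes S :: "('k, 'p::finite, 'f::finite) sbp"
  assumes "invertible (Hmat S k)"
  shows "invertible (Hbar S k)"
proof -
  have "x = 0" if "Hbar S k *v x = 0" for x
  proof -
    obtain a b where x: "x = vec_append a b"
      by (rule vec_append_cases)
    have zero: "0 = vec_append (0 :: real^'p) (0 :: real^'p)"
      by (auto simp: vec_append_def vec_eq_iff split: sum.split)
    have "Hmat S k *v a = 0" "Hmat S k *v b = 0"
      using that vec_append_eq_iff[of "Hmat S k *v a" "Hmat S k *v b" 0 0]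
      by (simp_all add: x Hbar_mult flip: zero)
    then have "a = 0" "b = 0"
      using invertible_inv_mult[OF assms, of a] invertible_inv_mult[OF assms, of b] by simp_all
    then show ?thesis
      using x zero by simp
  qed
  then show ?thesis
    by (simp add: invertible_left_inverse matrix_left_invertible_ker)
qed

lemma sym_mat_2: "sym_mat (A :: real^2^2) \<Longrightarrow> A $ 2 $ 1 = A $ 1 $ 2"
  unfolding sym_mat_def by (drule arg_cong[where f = "\<lambda>A. A $ 1 $ 2"]) (simp add: transpose_def)

text \<open>Written in components to match the contribution of a single node to the quadratic form
  of \<open>Lambda\<close>.\<close>

lemma spd_2_nonneg:
  assumes "spd (A :: real^2^2)"
  shows "0 \<le> x * (A $ 1 $ 1 * x + A $ 1 $ 2 * y) + y * (A $ 2 $ 1 * x + A $ 2 $ 2 * y)"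
proof -
  define v :: "real^2" where "v = vector [x, y]"
  have "0 \<le> v \<bullet> (A *v v)"
    using assms unfolding spd_def by (cases "v = 0") (auto intro: less_imp_le)
  then show ?thesis
    by (simp add: v_def inner_vec_def matrix_vector_mult_def sum_2)
qed

lemma inner_Lambda:
  "vec_append a b \<bullet> (Lambda P S k *v vec_append x y) = (\<Sum>i\<in>UNIV. let l = lam P (vol_node S k i) in
     a $ i * (l $ 1 $ 1 * x $ i + l $ 1 $ 2 * y $ i) + b $ i * (l $ 2 $ 1 * x $ i + l $ 2 $ 2 * y $ i))"
  unfolding Lambda_mult inner_vec_append by (simp add: inner_vec_def sum.distrib Let_def)

lemma sym_mat_Lambda:
  assumes "\<And>i. sym_mat (lam P (vol_node S k i))"
  shows "sym_mat (Lambda P S k)"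
proof (rule sym_matI)
  fix x y
  show "x \<bullet> (Lambda P S k *v y) = y \<bullet> (Lambda P S k *v x)"
    by (cases x rule: vec_append_cases, cases y rule: vec_append_cases)
      (auto simp: inner_Lambda Let_def sym_mat_2[OF assms] algebra_simps intro!: sum.cong)
qed

text \<open>\<open>Lambda\<close> couples only the two components at one node, and a diagonal norm
  matrix scales both of them by the same number.\<close>

lemma Hbar_Lambda_commute:
  assumes "diagonal_mat (Hmat S k)"
  shows "Hbar S k *v (Lambda P S k *v x) = Lambda P S k *v (Hbar S k *v x)"
proof -
  note H = diag_mat_mult[of "\<lambda>i. Hmat S k $ i $ i", folded diagonal_mat_eq[OF assms]]
  obtain a b where x: "x = vec_append a b"
    by (rule vec_append_cases)
  show ?thesis
    by (simp add: x Hbar_mult Lambda_mult H algebra_simps)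
qed

text \<open>The form splits into a sum over nodes of the positive norm entry times the quadratic
  form of the diffusion tensor at that node.\<close>

lemma Hbar_Lambda_nonneg:
  assumes H: "diagonal_mat (Hmat S k)" "spd (Hmat S k)" and L: "\<And>i. spd (lam P (vol_node S k i))"
  shows "0 \<le> x \<bullet> (Hbar S k *v (Lambda P S k *v x))"
proof -
  note Hm = diag_mat_mult[of "\<lambda>i. Hmat S k $ i $ i", folded diagonal_mat_eq[OF H(1)]]
  obtain a b where x: "x = vec_append a b"
    by (rule vec_append_cases)
  let ?l = "\<lambda>i. lam P (vol_node S k i)"
  have "x \<bullet> (Hbar S k *v (Lambda P S k *v x)) = (\<Sum>i\<in>UNIV. Hmat S k $ i $ i *
      (a $ i * (?l i $ 1 $ 1 * a $ i + ?l i $ 1 $ 2 * b $ i) +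
       b $ i * (?l i $ 2 $ 1 * a $ i + ?l i $ 2 $ 2 * b $ i)))"
    unfolding x Hbar_mult Lambda_mult Hm inner_vec_append
    by (simp add: inner_vec_def distrib_left mult.left_commute flip: sum.distrib)
  also have "\<dots> \<ge> 0"
    using spd_2_nonneg[OF L] spd_diagonal_entry[OF H(2)]
    by (intro sum_nonneg mult_nonneg_nonneg) (auto intro: less_imp_le)
  finally show ?thesis .
qed

section \<open>Discrete gradient, dissipation and Green identity\<close>

definition grad :: "('k, 'p::finite, 'f::finite) sbp \<Rightarrow> 'k \<Rightarrow> real^'p \<Rightarrow> real^('p + 'p)" where
  "grad S k x = mat_over (Dxmat S k) (Dymat S k) *v x"

text \<open>Discrete counterpart of the integral of the diffusion energy density over the element,
  with the norm matrix as quadrature.\<close>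

definition dissipation :: "problem \<Rightarrow> ('k, 'p::finite, 'f::finite) sbp \<Rightarrow> 'k \<Rightarrow> real^'p \<Rightarrow> real" where
  "dissipation P S k x = grad S k x \<bullet> (Hbar S k *v (Lambda P S k *v grad S k x))"

text \<open>Discrete integration by parts: \<open>E\<close> is the boundary form, and the transposed
  summand moves the derivative onto \<open>x\<close>.\<close>

lemma summation_by_parts:
  assumes "sym_mat H" and "H ** D + transpose (H ** D) = E"
  shows "x \<bullet> (H *v (D *v y)) = x \<bullet> (E *v y) - (D *v x) \<bullet> (H *v y)"
proof -
  have "x \<bullet> (E *v y) = x \<bullet> (H *v (D *v y)) + (H *v (D *v x)) \<bullet> y"
    by (simp add: assms(2)[symmetric] matrix_vector_mult_add_rdistrib inner_add_right
        inner_transpose_mult matrix_vector_mul_assoc[symmetric] del: transpose_matrix_vector)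
  then show ?thesis
    using sym_mat_inner[OF assms(1), of y "D *v x"] by (simp add: inner_commute)
qed

lemma inner_facet_sum:
  fixes R :: "'i \<Rightarrow> real^'n^'m"
  shows "x \<bullet> ((\<Sum>\<gamma>\<in>F. transpose (R \<gamma>) ** B \<gamma> ** N \<gamma> ** R \<gamma>) *v y)
    = (\<Sum>\<gamma>\<in>F. (R \<gamma> *v x) \<bullet> (B \<gamma> *v (N \<gamma> *v (R \<gamma> *v y))))"
  by (simp add: sum_mat_vec_mult inner_sum_right matrix_vector_mul_assoc[symmetric]
      inner_transpose_mult del: transpose_matrix_vector)

lemma Dfacet_mult:
  "Dfacet P S \<gamma> k *v x = transpose (Nmat S \<gamma> k) *v (Rbar S \<gamma> k *v (Lambda P S k *v grad S k x))"
  by (simp add: Dfacet_def grad_def matrix_vector_mul_assoc[symmetric] del: transpose_matrix_vector)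

text \<open>With \<open>y\<close> and \<open>z\<close> the components of the discrete flux, the
  normal derivative takes the shape of the boundary terms in the SBP property for \<open>x\<close>
  and \<open>y\<close> added together.\<close>

lemma Dfacet_mult_components:
  assumes "Lambda P S k *v grad S k x = vec_append y z"
  shows "Dfacet P S \<gamma> k *v x = Nx S \<gamma> k *v (Rmat S \<gamma> k *v y) + Ny S \<gamma> k *v (Rmat S \<gamma> k *v z)"
proof -
  have "transpose (Nx S \<gamma> k) = Nx S \<gamma> k" "transpose (Ny S \<gamma> k) = Ny S \<gamma> k"
    using sym_mat_diag_mat unfolding Nx_def Ny_def sym_mat_def by blast+
  then show ?thesis
    unfolding Dfacet_mult assms Nmat_def Rbar_def mat_twice_mult transpose_mat_over_mult by simp
qed

lemma sbp_operatorsD: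
  assumes "sbp_operators M S" "k \<in> elems M"
  shows "vol_node S k i \<in> element M k" "diagonal_mat (Hmat S k)" "spd (Hmat S k)"
    "\<gamma> \<in> facets M k \<Longrightarrow> facet_node S \<gamma> j \<in> \<gamma>" "\<gamma> \<in> facets M k \<Longrightarrow> diagonal_mat (Bmat S \<gamma>)"
    "\<gamma> \<in> facets M k \<Longrightarrow> 0 < weight S \<gamma> k" "(\<Sum>\<gamma>\<in>facets M k. weight S \<gamma> k) = 1"
    "Hmat S k ** Dxmat S k + transpose (Hmat S k ** Dxmat S k) =
       (\<Sum>\<gamma>\<in>facets M k. transpose (Rmat S \<gamma> k) ** Bmat S \<gamma> ** Nx S \<gamma> k ** Rmat S \<gamma> k)"
    "Hmat S k ** Dymat S k + transpose (Hmat S k ** Dymat S k) =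
       (\<Sum>\<gamma>\<in>facets M k. transpose (Rmat S \<gamma> k) ** Bmat S \<gamma> ** Ny S \<gamma> k ** Rmat S \<gamma> k)"
  using assms unfolding sbp_operators_def by auto

text \<open>Summation by parts is applied in each coordinate to the matching component of the flux.
  The two boundary sums combine into the normal derivative, and the two volume terms into the
  dissipation.\<close>

lemma element_green_identity:
  assumes ops: "sbp_operators M S" "k \<in> elems M"
  shows "x \<bullet> (Hmat S k *v (D2 P S k *v x)) =
    (\<Sum>\<gamma>\<in>facets M k. (Rmat S \<gamma> k *v x) \<bullet> (Bmat S \<gamma> *v (Dfacet P S \<gamma> k *v x))) - dissipation P S k x"
proof -
  note op = sbp_operatorsD[OF ops]
  have H: "sym_mat (Hmat S k)"
    by (rule sym_mat_diagonal[OF op(2)])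
  obtain y z where yz: "Lambda P S k *v grad S k x = vec_append y z"
    by (rule vec_append_cases)
  have "D2 P S k *v x = Dxmat S k *v y + Dymat S k *v z"
    by (simp add: D2_def matrix_vector_mul_assoc[symmetric] grad_def[symmetric] yz mat_beside_mult)
  then have "x \<bullet> (Hmat S k *v (D2 P S k *v x)) =
      x \<bullet> (Hmat S k *v (Dxmat S k *v y)) + x \<bullet> (Hmat S k *v (Dymat S k *v z))"
    by (simp add: matrix_vector_right_distrib inner_add_right)
  also have "\<dots> = (\<Sum>\<gamma>\<in>facets M k. (Rmat S \<gamma> k *v x) \<bullet> (Bmat S \<gamma> *v (Nx S \<gamma> k *v (Rmat S \<gamma> k *v y))))
      + (\<Sum>\<gamma>\<in>facets M k. (Rmat S \<gamma> k *v x) \<bullet> (Bmat S \<gamma> *v (Ny S \<gamma> k *v (Rmat S \<gamma> k *v z))))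
      - ((Dxmat S k *v x) \<bullet> (Hmat S k *v y) + (Dymat S k *v x) \<bullet> (Hmat S k *v z))"
    unfolding summation_by_parts[OF H op(8)] summation_by_parts[OF H op(9)] inner_facet_sum by simp
  also have "(Dxmat S k *v x) \<bullet> (Hmat S k *v y) + (Dymat S k *v x) \<bullet> (Hmat S k *v z) = dissipation P S k x"
    unfolding dissipation_def yz Hbar_mult by (simp add: grad_def mat_over_mult inner_vec_append)
  finally show ?thesis
    unfolding Dfacet_mult_components[OF yz]
    by (simp add: matrix_vector_right_distrib inner_add_right sum.distrib)
qed

text \<open>Weighted Cauchy-Schwarz between the gradient and \<open>w\<close>, the lifting of the facet values of
  \<open>x\<close> to the volume nodes; \<open>\<Upsilon>\<close> is what remains of the square of \<open>w\<close>.\<close>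

lemma dirichlet_facet_bound:
  fixes x :: "real^'p::finite"
  assumes H: "diagonal_mat (Hmat S k)" "spd (Hmat S k)" and L: "\<And>i. spd (lam P (vol_node S k i))"
    and B: "diagonal_mat (Bmat S \<gamma>)" and "0 < \<alpha>"
    and T: "pos_semidef (T - (1 / \<alpha>) *\<^sub>R (Bmat S \<gamma> ** Upsilon P S \<gamma> \<gamma> k ** Bmat S \<gamma>))"
  shows "2 * ((Rmat S \<gamma> k *v x) \<bullet> (Bmat S \<gamma> *v (Dfacet P S \<gamma> k *v x)))
    \<le> (Rmat S \<gamma> k *v x) \<bullet> (T *v (Rmat S \<gamma> k *v x)) + \<alpha> * dissipation P S k x"
proof -
  let ?B = "Bmat S \<gamma>" and ?L = "Lambda P S k" and ?G = "Hbar S k"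
  let ?a = "Rmat S \<gamma> k *v x" and ?g = "grad S k x"
  define w where "w = transpose (Rbar S \<gamma> k) *v (Nmat S \<gamma> k *v (?B *v ?a))"
  have symB: "(?B *v ?a) \<bullet> y = ?a \<bullet> (?B *v y)" for y
    using sym_mat_inner[OF sym_mat_diagonal[OF B], of ?a y] by (simp add: inner_commute)
  have L': "\<And>i. sym_mat (lam P (vol_node S k i))"
    using L by (simp add: spd_def)
  \<comment> \<open>Pairing with the lifting \<open>w\<close> equals pairing on the facet. Taking
    for \<open>y\<close> the flux yields the boundary term in \<open>1\<close>; taking
    \<open>matrix_inv ?G *v (?L *v w)\<close> yields the \<Upsilon> form in
    \<open>2\<close>.\<close>
  have w: "y \<bullet> w = (?B *v ?a) \<bullet> (transpose (Nmat S \<gamma> k) *v (Rbar S \<gamma> k *v y))" for y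
    by (simp add: w_def inner_transpose_mult inner_commute del: transpose_matrix_vector)
  have 1: "w \<bullet> (?L *v ?g) = ?a \<bullet> (?B *v (Dfacet P S \<gamma> k *v x))"
    using w[of "?L *v ?g"] symB
    by (simp add: Dfacet_mult inner_commute del: transpose_matrix_vector)
  have 2: "w \<bullet> (matrix_inv ?G *v (?L *v w)) = ?a \<bullet> ((?B ** Upsilon P S \<gamma> \<gamma> k ** ?B) *v ?a)"
    using w[of "matrix_inv ?G *v (?L *v w)"] symB
    by (simp add: Upsilon_def matrix_vector_mul_assoc[symmetric] w_def inner_commute
        del: transpose_matrix_vector)
  have "2 * (w \<bullet> (?L *v ?g)) \<le> (1 / \<alpha>) * (w \<bullet> (matrix_inv ?G *v (?L *v w))) + \<alpha> * dissipation P S k x"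
    unfolding dissipation_def
    by (intro weighted_cauchy_schwarz sym_mat_Hbar sym_mat_diagonal invertible_Hbar spd_invertible
        sym_mat_Lambda Hbar_Lambda_commute Hbar_Lambda_nonneg H L L' \<open>0 < \<alpha>\<close>)
  moreover have "0 \<le> ?a \<bullet> (T *v ?a) - (1 / \<alpha>) * (?a \<bullet> ((?B ** Upsilon P S \<gamma> \<gamma> k ** ?B) *v ?a))"
    using T unfolding pos_semidef_def
    by (metis inner_diff_right inner_scaleR_right matrix_vector_mult_diff_rdistrib
        scaleR_matrix_vector_assoc)
  ultimately show ?thesis
    unfolding 1 2 by linarith
qed

section \<open>Penalty terms\<close>

text \<open>The penalties coupling different facets vanish with \<open>T5\<close> and
  \<open>T6\<close>; in the rest the transposes are moved onto the test vector
  \<open>x\<close>.\<close>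

lemma inner_sat_interior:
  fixes S :: "('k, 'p::finite, 'f::finite) sbp"
  assumes mesh: "mesh_of P M" and k: "k \<in> elems M"
    and T56: "\<And>v a b. v \<in> elems M \<Longrightarrow> a \<in> interior_facets M v \<Longrightarrow> b \<in> interior_facets M v - {a} \<Longrightarrow>
      T5 C a b v = 0 \<and> T6 C a b v = 0"
  shows "x \<bullet> sat_interior P M S C u k = (\<Sum>\<gamma>\<in>interior_facets M k.
    (Rmat S \<gamma> k *v x) \<bullet> (T1 C \<gamma> k *v jump M S u \<gamma> k + T3 C \<gamma> k *v flux_sum P M S u \<gamma> k)
    + (Dfacet P S \<gamma> k *v x) \<bullet> (T2 C \<gamma> k *v jump M S u \<gamma> k + T4 C \<gamma> k *v flux_sum P M S u \<gamma> k))"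
proof -
  have "(let v = nbr M \<gamma> k in
        (\<Sum>\<epsilon>\<in>interior_facets M k - {\<gamma>}.
           (transpose (Rmat S \<gamma> k) ** T5 C \<gamma> \<epsilon> k) *v jump M S u \<epsilon> k) +
        (\<Sum>\<delta>\<in>interior_facets M v - {\<gamma>}.
           (transpose (Rmat S \<gamma> k) ** T6 C \<gamma> \<delta> v) *v jump M S u \<delta> v)) = 0"
    if "\<gamma> \<in> interior_facets M k" for \<gamma>
  proof -
    let ?v = "nbr M \<gamma> k"
    have a: "adjacent M \<gamma> ?v k"
      using adjacent_nbr[OF mesh k that] by (simp add: adjacent_commute)
    then have v: "?v \<in> elems M"
      by (simp add: adjacent_def)
    \<comment> \<open>The \<open>T6\<close> coefficients belong to the neighbour, so their vanishing
      is invoked at \<open>?v\<close>, where \<gamma> must again be an interior facet.\<close>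
    have "\<gamma> \<in> interior_facets M ?v"
      using a interior_facet_iff[OF v] by auto
    then show ?thesis
      using T56[OF k that] T56[OF v] by (simp add: Let_def)
  qed
  then have "sat_interior P M S C u k = (\<Sum>\<gamma>\<in>interior_facets M k.
        (mat_beside (transpose (Rmat S \<gamma> k)) (transpose (Dfacet P S \<gamma> k))
           ** mat_block (T1 C \<gamma> k) (T3 C \<gamma> k) (T2 C \<gamma> k) (T4 C \<gamma> k))
        *v vec_append (jump M S u \<gamma> k) (flux_sum P M S u \<gamma> k))"
    unfolding sat_interior_def by simp
  then show ?thesis
    by (simp add: inner_sum_right matrix_vector_mul_assoc[symmetric] mat_block_mult mat_beside_mult
        inner_add_right[of x] inner_transpose_mult del: transpose_matrix_vector)
qed

lemma inner_sat_boundary: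
  fixes S :: "('k, 'p::finite, 'f::finite) sbp"
  assumes ops: "sbp_operators M S" "k \<in> elems M" and hom: "homogeneous P"
  shows "x \<bullet> sat_boundary P M S C t u k =
    (\<Sum>\<gamma>\<in>dirichlet_facets P M k. (Rmat S \<gamma> k *v x) \<bullet> (TD C \<gamma> *v (Rmat S \<gamma> k *v u k))
       - (Dfacet P S \<gamma> k *v x) \<bullet> (Bmat S \<gamma> *v (Rmat S \<gamma> k *v u k))) +
    (\<Sum>\<gamma>\<in>neumann_facets P M k. (Rmat S \<gamma> k *v x) \<bullet> (Bmat S \<gamma> *v (Dfacet P S \<gamma> k *v u k)))"
proof -
  have D: "(\<chi> j. dirichlet_data P t (facet_node S \<gamma> j)) = 0" if "\<gamma> \<in> dirichlet_facets P M k" for \<gamma>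
  proof -
    have "facet_node S \<gamma> j \<in> GammaD P" for j
      using that sbp_operatorsD(4)[OF ops, of \<gamma> j] by (auto simp: dirichlet_facets_def)
    then show ?thesis
      using hom by (simp add: homogeneous_def vec_eq_iff)
  qed
  have N: "(\<chi> j. neumann_data P t (facet_node S \<gamma> j)) = 0" if "\<gamma> \<in> neumann_facets P M k" for \<gamma>
  proof -
    have "facet_node S \<gamma> j \<in> GammaN P" for j
      using that sbp_operatorsD(4)[OF ops, of \<gamma> j] by (auto simp: neumann_facets_def)
    then show ?thesis
      using hom by (simp add: homogeneous_def vec_eq_iff)
  qed
  have minus: "(- A) *v y = - (A *v y)" for A :: "real^'f^'f" and y
    by (simp add: matrix_vector_mult_def vec_eq_iff sum_negf)
  show ?thesis
    by (simp add: sat_boundary_def D N inner_add_right[of x] inner_sum_right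
        matrix_vector_mul_assoc[symmetric] mat_over_mult mat_beside_mult inner_transpose_mult minus
        del: transpose_matrix_vector cong: sum.cong)
qed

text \<open>Here \<open>a, b\<close> are the traces and \<open>p, q\<close> the fluxes from the two sides, and the coefficients
  \<open>T2\<close> have been replaced by the \<open>T3\<close> of the opposite side.\<close>

lemma interior_facet_cancellation:
  fixes a b p q :: "real^'n"
  assumes sym: "sym_mat Ck" "sym_mat Cv" and B: "Ck + Cv = B"
    and psd: "pos_semidef A" "pos_semidef D"
  shows "a \<bullet> (B *v p) - (a \<bullet> (A *v (a - b) + Ck *v (p + q)) + p \<bullet> (Cv *v (a - b) + D *v (p + q)))
    + (b \<bullet> (B *v q) - (b \<bullet> (A *v (b - a) + Cv *v (q + p)) + q \<bullet> (Ck *v (b - a) + D *v (q + p)))) \<le> 0"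
proof -
  \<comment> \<open>The expression to be bounded is exactly minus the sum of these two squares: by
    symmetry of \<open>Ck\<close> and \<open>Cv\<close> all products of a trace with a flux
    cancel.\<close>
  have "0 \<le> (a - b) \<bullet> (A *v (a - b))" "0 \<le> (p + q) \<bullet> (D *v (p + q))"
    using psd by (simp_all add: pos_semidef_def)
  then show ?thesis
    using sym_mat_inner[OF sym(1), of q a] sym_mat_inner[OF sym(1), of q b]
      sym_mat_inner[OF sym(2), of p a] sym_mat_inner[OF sym(2), of p b]
    by (simp add: B[symmetric] matrix_vector_mult_add_rdistrib matrix_vector_right_distrib
        matrix_vector_mult_diff_distrib inner_add_left inner_add_right inner_diff_left
        inner_diff_right)
qed

section \<open>Energy rate\<close>

lemma has_real_derivative_quadratic_form:
  assumes "sym_mat A" and "(f has_vector_derivative d) (at t within I)"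
  shows "((\<lambda>s. f s \<bullet> (A *v f s)) has_real_derivative 2 * (f t \<bullet> (A *v d))) (at t within I)"
proof -
  have "((\<lambda>s. A *v f s) has_vector_derivative A *v d) (at t within I)"
    by (rule bounded_linear.has_vector_derivative[OF matrix_vector_mul_bounded_linear assms(2)])
  from bounded_bilinear.has_vector_derivative[OF bounded_bilinear_inner assms(2) this]
  show ?thesis
    using sym_mat_inner[OF assms(1), of "f t" d]
    by (simp add: has_real_derivative_iff_has_vector_derivative)
qed

text \<open>The norm matrix cancels its inverse in front of the penalties, and the source vanishes
  because all volume nodes lie in the domain.\<close>

lemma inner_semidiscrete_rhs:
  assumes prob: "dom P = (\<Union>k\<in>elems M. element M k)" "homogeneous P"
    and ops: "sbp_operators M S" "k \<in> elems M"
  shows "x \<bullet> (Hmat S k *v semidiscrete_rhs P M S C t u k) = x \<bullet> (Hmat S k *v (D2 P S k *v u k))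
    - x \<bullet> sat_interior P M S C u k - x \<bullet> sat_boundary P M S C t u k"
proof -
  have "vol_node S k i \<in> dom P" for i
    using sbp_operatorsD(1)[OF ops, of i] prob(1) ops(2) by auto
  then have "(\<chi> i. src P t (vol_node S k i)) = 0"
    using prob(2) by (simp add: homogeneous_def vec_eq_iff)
  then show ?thesis
    using spd_invertible[OF sbp_operatorsD(3)[OF ops]]
    by (simp add: semidiscrete_rhs_def matrix_vector_mult_diff_distrib inner_diff_right
        invertible_mult_inv)
qed

text \<open>Half the energy rate at an arbitrary grid function. Each element is first bounded by its
  interior facet terms alone; these are then paired across facets.\<close>

lemma energy_rate_nonpos:
  fixes S :: "('k, 'p::finite, 'f::finite) sbp" and C :: "('k, 'f) sat"
  assumes disc: "sbp_sat_discretization P M S C" and hom: "homogeneous P"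
    and int: "\<And>\<gamma> k v. adjacent M \<gamma> k v \<Longrightarrow> T1 C \<gamma> k = T1 C \<gamma> v \<and> T2 C \<gamma> k = T3 C \<gamma> v \<and>
      T3 C \<gamma> k + T3 C \<gamma> v = Bmat S \<gamma> \<and> T4 C \<gamma> k = T4 C \<gamma> v \<and>
      pos_semidef (T1 C \<gamma> k) \<and> pos_semidef (T4 C \<gamma> k)"
    and TD: "\<And>k \<gamma>. k \<in> elems M \<Longrightarrow> \<gamma> \<in> dirichlet_facets P M k \<Longrightarrow>
      pos_semidef (TD C \<gamma> - (1 / weight S \<gamma> k) *\<^sub>R (Bmat S \<gamma> ** Upsilon P S \<gamma> \<gamma> k ** Bmat S \<gamma>))"
    and T56: "\<And>k a b. k \<in> elems M \<Longrightarrow> a \<in> interior_facets M k \<Longrightarrow> b \<in> interior_facets M k - {a} \<Longrightarrow>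
      T5 C a b k = 0 \<and> T6 C a b k = 0"
  shows "(\<Sum>k\<in>elems M. u k \<bullet> (Hmat S k *v semidiscrete_rhs P M S C t u k)) \<le> 0"
proof -
  have mesh: "mesh_of P M" and ops: "sbp_operators M S" and diff: "diffusion_problem P"
    and sym: "sat_symmetric P M C"
    using disc by (auto simp: sbp_sat_discretization_def)
  have dom: "dom P = (\<Union>k\<in>elems M. element M k)"
    using mesh by (simp add: mesh_of_def)
  \<comment> \<open>\<open>a\<close> is the trace, \<open>p\<close> the normal flux,
    \<open>sat\<close> the interior penalty tested with \<open>u k\<close>, and \<open>f\<close>
    what an interior facet leaves in the rate after the penalty is subtracted.\<close>
  define a p where "a k \<gamma> = Rmat S \<gamma> k *v u k" and "p k \<gamma> = Dfacet P S \<gamma> k *v u k" for k \<gamma>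
  define sat where "sat k \<gamma> =
      a k \<gamma> \<bullet> (T1 C \<gamma> k *v jump M S u \<gamma> k + T3 C \<gamma> k *v flux_sum P M S u \<gamma> k)
    + p k \<gamma> \<bullet> (T2 C \<gamma> k *v jump M S u \<gamma> k + T4 C \<gamma> k *v flux_sum P M S u \<gamma> k)" for k \<gamma>
  define f where "f k \<gamma> = a k \<gamma> \<bullet> (Bmat S \<gamma> *v p k \<gamma>) - sat k \<gamma>" for k \<gamma>
  have elem: "u k \<bullet> (Hmat S k *v semidiscrete_rhs P M S C t u k) \<le> (\<Sum>\<gamma>\<in>interior_facets M k. f k \<gamma>)"
    if k: "k \<in> elems M" for k
  proof -
    note op = sbp_operatorsD[OF ops k]
    have L: "spd (lam P (vol_node S k i))" for i
      using op(1)[of i] diff dom k by (auto simp: diffusion_problem_def)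
    have diss: "0 \<le> dissipation P S k (u k)"
      unfolding dissipation_def by (rule Hbar_Lambda_nonneg[where S = S, OF op(2,3) L])
    have DF: "dirichlet_facets P M k \<subseteq> facets M k"
      by (auto simp: dirichlet_facets_def)
    \<comment> \<open>The positive weights of the Dirichlet facets sum to at most 1, so the
      fractions of the nonnegative dissipation spent on them do not exceed the whole.\<close>
    have "(\<Sum>\<gamma>\<in>dirichlet_facets P M k. weight S \<gamma> k) \<le> (\<Sum>\<gamma>\<in>facets M k. weight S \<gamma> k)"
      by (rule sum_mono2[OF finite_facets DF]) (use op(6) less_imp_le in blast)
    then have "(\<Sum>\<gamma>\<in>dirichlet_facets P M k. weight S \<gamma> k) * dissipation P S k (u k) \<le> dissipation P S k (u k)"
      using mult_right_mono[OF _ diss, of _ 1] op(7) by simp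
    moreover have "(\<Sum>\<gamma>\<in>dirichlet_facets P M k. 2 * (a k \<gamma> \<bullet> (Bmat S \<gamma> *v p k \<gamma>)))
        \<le> (\<Sum>\<gamma>\<in>dirichlet_facets P M k. a k \<gamma> \<bullet> (TD C \<gamma> *v a k \<gamma>) + weight S \<gamma> k * dissipation P S k (u k))"
      unfolding a_def p_def using DF
      by (intro sum_mono dirichlet_facet_bound op(2,3,5,6) L TD[OF k]) auto
    ultimately have dirichlet: "(\<Sum>\<gamma>\<in>dirichlet_facets P M k. 2 * (a k \<gamma> \<bullet> (Bmat S \<gamma> *v p k \<gamma>)))
        \<le> (\<Sum>\<gamma>\<in>dirichlet_facets P M k. a k \<gamma> \<bullet> (TD C \<gamma> *v a k \<gamma>)) + dissipation P S k (u k)"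
      by (simp add: sum.distrib sum_distrib_right)
    have swap: "p k \<gamma> \<bullet> (Bmat S \<gamma> *v a k \<gamma>) = a k \<gamma> \<bullet> (Bmat S \<gamma> *v p k \<gamma>)"
      if "\<gamma> \<in> dirichlet_facets P M k" for \<gamma>
      using sym_mat_inner[OF sym_mat_diagonal[OF op(5)]] DF that by blast
    \<comment> \<open>Subtracted from the Green identity, the second sum doubles the Dirichlet
      boundary term, which explains the factor 2 in \<open>dirichlet\<close>, and the third cancels
      the Neumann one.\<close>
    have "u k \<bullet> sat_boundary P M S C t u k =
        (\<Sum>\<gamma>\<in>dirichlet_facets P M k. a k \<gamma> \<bullet> (TD C \<gamma> *v a k \<gamma>))
        - (\<Sum>\<gamma>\<in>dirichlet_facets P M k. a k \<gamma> \<bullet> (Bmat S \<gamma> *v p k \<gamma>))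
        + (\<Sum>\<gamma>\<in>neumann_facets P M k. a k \<gamma> \<bullet> (Bmat S \<gamma> *v p k \<gamma>))"
      unfolding inner_sat_boundary[OF ops k hom] a_def[symmetric] p_def[symmetric]
      by (simp add: sum_subtractf swap)
    moreover have "u k \<bullet> sat_interior P M S C u k = (\<Sum>\<gamma>\<in>interior_facets M k. sat k \<gamma>)"
      unfolding sat_def a_def p_def by (rule inner_sat_interior[OF mesh k T56])
    moreover have "u k \<bullet> (Hmat S k *v (D2 P S k *v u k)) =
        (\<Sum>\<gamma>\<in>interior_facets M k. a k \<gamma> \<bullet> (Bmat S \<gamma> *v p k \<gamma>))
        + (\<Sum>\<gamma>\<in>dirichlet_facets P M k. a k \<gamma> \<bullet> (Bmat S \<gamma> *v p k \<gamma>))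
        + (\<Sum>\<gamma>\<in>neumann_facets P M k. a k \<gamma> \<bullet> (Bmat S \<gamma> *v p k \<gamma>)) - dissipation P S k (u k)"
      unfolding element_green_identity[OF ops k] sum_facets[OF mesh k] a_def p_def ..
    ultimately show ?thesis
      using dirichlet unfolding inner_semidiscrete_rhs[OF dom hom ops k] f_def
      by (simp add: sum_subtractf sum_distrib_left[symmetric])
  qed
  have "f k \<gamma> + f v \<gamma> \<le> 0" if adj: "adjacent M \<gamma> k v" for \<gamma> k v
  proof -
    have adj': "adjacent M \<gamma> v k"
      using adj by (simp add: adjacent_commute)
    have kv: "k \<in> elems M" "v \<in> elems M"
      using adj by (auto simp: adjacent_def)
    have "\<gamma> \<in> interior_facets M k" "\<gamma> \<in> interior_facets M v"
      using interior_facet_iff[OF kv(1)] interior_facet_iff[OF kv(2)] adj adj' by auto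
    then have sym3: "sym_mat (T3 C \<gamma> k)" "sym_mat (T3 C \<gamma> v)"
      using sym kv by (auto simp: sat_symmetric_def)
    have coeffs: "T3 C \<gamma> k + T3 C \<gamma> v = Bmat S \<gamma>" "pos_semidef (T1 C \<gamma> k)"
        "pos_semidef (T4 C \<gamma> k)"
      using int[OF adj] by fast+
    \<comment> \<open>Reading \<open>int\<close> from both sides of the facet expresses each
      \<open>T2\<close> by the opposite \<open>T3\<close>, as the cancellation requires.\<close>
    have *: "T1 C \<gamma> v = T1 C \<gamma> k" "T2 C \<gamma> k = T3 C \<gamma> v" "T2 C \<gamma> v = T3 C \<gamma> k"
        "T4 C \<gamma> v = T4 C \<gamma> k"
      using int[OF adj] int[OF adj'] by simp_all
    show ?thesis
      unfolding f_def sat_def jump_def flux_sum_def nbr_eq[OF mesh adj] nbr_eq[OF mesh adj']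
        a_def[symmetric] p_def[symmetric] *
      by (rule interior_facet_cancellation[OF sym3 coeffs])
  qed
  then have "(\<Sum>k\<in>elems M. \<Sum>\<gamma>\<in>interior_facets M k. f k \<gamma>) \<le> 0"
    by (rule sum_interior_facets_nonpos[OF mesh])
  moreover have "(\<Sum>k\<in>elems M. u k \<bullet> (Hmat S k *v semidiscrete_rhs P M S C t u k))
      \<le> (\<Sum>k\<in>elems M. \<Sum>\<gamma>\<in>interior_facets M k. f k \<gamma>)"
    by (intro sum_mono elem)
  ultimately show ?thesis
    by linarith
qed

theorem theorem7:
  fixes P :: problem and M :: "'k mesh"
    and S :: "('k, 'p::finite, 'f::finite) sbp" and C :: "('k, 'f) sat"
  assumes "sbp_sat_discretization P M S C"
    and "homogeneous P"
    and "conservative M S C"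
    and "\<not> adjoint_conditions M S C"
    and "\<And>\<gamma> k v. adjacent M \<gamma> k v \<Longrightarrow>
           T3 C \<gamma> k + T2 C \<gamma> k - Bmat S \<gamma> = 0 \<and>
           T3 C \<gamma> v + T2 C \<gamma> v - Bmat S \<gamma> = 0 \<and>
           T3 C \<gamma> v - T2 C \<gamma> k = 0 \<and>
           T3 C \<gamma> k - T2 C \<gamma> v = 0 \<and>
           pos_semidef (T1 C \<gamma> k) \<and>
           T4 C \<gamma> k = T4 C \<gamma> v \<and> pos_semidef (T4 C \<gamma> v)"
    and "\<And>k \<gamma>. k \<in> elems M \<Longrightarrow> \<gamma> \<in> dirichlet_facets P M k \<Longrightarrow>
           pos_semidef (TD C \<gamma> - (1 / weight S \<gamma> k) *\<^sub>R
             (Bmat S \<gamma> ** Upsilon P S \<gamma> \<gamma> k ** Bmat S \<gamma>))"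
    and "\<And>k a b. k \<in> elems M \<Longrightarrow> a \<in> interior_facets M k \<Longrightarrow> b \<in> interior_facets M k - {a} \<Longrightarrow>
           T5 C a b k = - T6 C a b k \<and> - T6 C a b k = 0"
  shows "energy_stable P M S C (Hmat S)"
proof -
  have ops: "sbp_operators M S"
    using assms(1) by (simp add: sbp_sat_discretization_def)
  have rate: "(\<Sum>k\<in>elems M. u k \<bullet> (Hmat S k *v semidiscrete_rhs P M S C t u k)) \<le> 0" for u t
  proof (rule energy_rate_nonpos[OF assms(1,2) _ assms(6)])
    fix \<gamma> k v
    assume adj: "adjacent M \<gamma> k v"
    then have "T1 C \<gamma> k = T1 C \<gamma> v" "T3 C \<gamma> k + T3 C \<gamma> v = Bmat S \<gamma>"
      using assms(3) unfolding conservative_def by blast+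
    \<comment> \<open>Conservation supplies the \<open>T1\<close> equality and the sum of the
      \<open>T3\<close>; semidefiniteness of \<open>T4\<close> passes from \<open>v\<close> to
      \<open>k\<close> by their equality.\<close>
    then show "T1 C \<gamma> k = T1 C \<gamma> v \<and> T2 C \<gamma> k = T3 C \<gamma> v \<and>
      T3 C \<gamma> k + T3 C \<gamma> v = Bmat S \<gamma> \<and> T4 C \<gamma> k = T4 C \<gamma> v \<and>
      pos_semidef (T1 C \<gamma> k) \<and> pos_semidef (T4 C \<gamma> k)"
      using assms(5)[OF adj] by simp
  next
    fix k a b
    assume "k \<in> elems M" "a \<in> interior_facets M k" "b \<in> interior_facets M k - {a}"
    from assms(7)[OF this] show "T5 C a b k = 0 \<and> T6 C a b k = 0"
      by simp
  qed
  show ?thesis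
    unfolding energy_stable_def
  proof (intro allI impI ballI)
    fix tf u t
    assume "semidiscrete_solution P M S C tf u" and t: "t \<in> {0..tf}"
    then have deriv: "((\<lambda>s. u s k) has_vector_derivative semidiscrete_rhs P M S C t (u t) k)
        (at t within {0..tf})" if "k \<in> elems M" for k
      using that by (simp add: semidiscrete_solution_def)
    \<comment> \<open>Symmetry of the diagonal norm matrix merges the two product rule terms into a
      factor 2, so this derivative is twice the sum bounded in \<open>rate\<close>.\<close>
    have "((\<lambda>s. energy M (Hmat S) (u s)) has_real_derivative
        (\<Sum>k\<in>elems M. 2 * (u t k \<bullet> (Hmat S k *v semidiscrete_rhs P M S C t (u t) k))))
        (at t within {0..tf})"
      unfolding energy_def
      by (intro DERIV_sum has_real_derivative_quadratic_form sym_mat_diagonal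
          sbp_operatorsD(2)[OF ops] deriv)
    moreover have "(\<Sum>k\<in>elems M. 2 * (u t k \<bullet> (Hmat S k *v semidiscrete_rhs P M S C t (u t) k))) \<le> 0"
      using rate[of "u t" t] by (simp add: sum_distrib_left[symmetric])
    ultimately show "\<exists>d \<le> 0. ((\<lambda>s. energy M (Hmat S) (u s)) has_real_derivative d)
        (at t within {0..tf})"
      by blast
  qed
qed

end
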